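(* For every $k \in \mathbb{N}$ there exists a strongly connected oriented graph $D$, with underlying undirected graph $G$, such that $c(D) - c(G) > k$.
   Context: All graphs are finite. An oriented graph is a directed graph without loops and without parallel or opposite arcs, i.e. a simple undirected graph (its underlying graph) each of whose edges has been assigned one direction. Game of cops and robbers with $m$ cops on a graph or digraph: first each of the $m$ cops chooses a starting vertex (several cops may share a vertex), then the robber chooses a starting vertex. The game proceeds in rounds: in each round every cop either stays in place or moves to an adjacent vertex, after which the robber either stays in place or moves to an adjacent vertex. In an undirected graph agents move along edges; in a digraph an agent at $u$ may move to $v$ only if $(u,v)$ is an arc. All positions are known to everyone. The cops win if after finitely many rounds some cop occupies the same vertex as the robber; the robber wins if he avoids this forever. The cop number $c(G)$ (or $c(D)$) is the least $m$ for which $m$ cops have a winning strategy. *)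

theory Defs
  imports "Graph_Theory.Digraph_Component"
begin

locale oriented_graph = digraph +
  assumes no_opposite_arcs: "u \<rightarrow> v \<Longrightarrow> \<not> v \<rightarrow> u"

text \<open>
  The game is defined on digraphs. An undirected graph is a symmetric digraph, as everywhere in
  the Graph\_Theory library; there, moving along an arc is the same as moving along an edge.
\<close>

definition agent_move :: "('a, 'b) pre_digraph \<Rightarrow> 'a \<Rightarrow> 'a \<Rightarrow> bool" where
  "agent_move G u v \<longleftrightarrow> v = u \<or> u \<rightarrow>\<^bsub>G\<^esub> v"

text \<open>\<open>r t\<close> is the position of the robber after round \<open>t\<close>; \<open>r 0\<close> is his starting vertex.\<close>

definition robber_play :: "('a, 'b) pre_digraph \<Rightarrow> (nat \<Rightarrow> 'a) \<Rightarrow> bool" where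
  "robber_play G r \<longleftrightarrow> r 0 \<in> verts G \<and> (\<forall>t. agent_move G (r t) (r (Suc t)))"

text \<open>
  A strategy \<open>s\<close> maps the list of all robber positions so far to the new positions of the cops
  (cop \<open>i\<close> is the \<open>i\<close>-th entry of the list). In particular \<open>s []\<close> is the starting placement,
  chosen before the robber chooses his vertex. The cops' own earlier positions are determined
  by \<open>s\<close> and the robber positions, so they need not be arguments of \<open>s\<close>.
\<close>

definition cops_at :: "('a list \<Rightarrow> 'a list) \<Rightarrow> (nat \<Rightarrow> 'a) \<Rightarrow> nat \<Rightarrow> 'a list" where
  "cops_at s r t = s (map r [0..<t])"

definition cop_strategy :: "('a, 'b) pre_digraph \<Rightarrow> nat \<Rightarrow> ('a list \<Rightarrow> 'a list) \<Rightarrow> bool" where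
  "cop_strategy G m s \<longleftrightarrow>
     length (s []) = m \<and> set (s []) \<subseteq> verts G \<and>
     (\<forall>r. robber_play G r \<longrightarrow>
        (\<forall>t. list_all2 (agent_move G) (cops_at s r t) (cops_at s r (Suc t))))"

text \<open>
  In round \<open>Suc t\<close> the cops move first, so the robber at \<open>r t\<close> can be caught either because he
  placed himself on or moved onto a cop, or by the cops' next move. The game is over at that
  moment; what \<open>s\<close> and \<open>r\<close> prescribe afterwards is irrelevant.
\<close>

definition winning_cop_strategy ::
    "('a, 'b) pre_digraph \<Rightarrow> nat \<Rightarrow> ('a list \<Rightarrow> 'a list) \<Rightarrow> bool" where
  "winning_cop_strategy G m s \<longleftrightarrow>
     cop_strategy G m s \<and>
     (\<forall>r. robber_play G r \<longrightarrow>
        (\<exists>t. r t \<in> set (cops_at s r t) \<or> r t \<in> set (cops_at s r (Suc t))))"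

definition cops_win :: "('a, 'b) pre_digraph \<Rightarrow> nat \<Rightarrow> bool" where
  "cops_win G m \<longleftrightarrow> (\<exists>s. winning_cop_strategy G m s)"

definition cop_number :: "('a, 'b) pre_digraph \<Rightarrow> nat" where
  "cop_number G = (LEAST m. cops_win G m)"

text \<open>On a finite digraph the least number exists, since one cop per vertex suffices.\<close>

lemma (in fin_digraph) cops_win_card_verts: "cops_win G (card (verts G))"
proof -
  obtain vs where vs: "set vs = verts G" "distinct vs"
    using finite_distinct_list[OF finite_verts] by blast
  have "winning_cop_strategy G (card (verts G)) (\<lambda>_. vs)"
    unfolding winning_cop_strategy_def cop_strategy_def cops_at_def robber_play_def
    using vs by (auto simp: list_all2_same agent_move_def distinct_card[symmetric])
  then show ?thesis
    unfolding cops_win_def by blast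
qed

lemma (in fin_digraph) cops_win_cop_number: "cops_win G (cop_number G)"
  unfolding cop_number_def by (rule LeastI) (rule cops_win_card_verts)

end

theory Submission
  imports Defs "HOL-Number_Theory.Cong"
begin

text \<open>
  Take for \<open>D\<close> the circulant digraph on \<open>\<int>/n\<close> with arcs \<open>x \<rightarrow> x + (2\<^sup>i - 1)\<close> for \<open>1 \<le> i \<le> m\<close> and
  \<open>n = 2\<^bsup>m+2\<^esup>\<close>, together with one further vertex that is joined to all others but has a single
  out-neighbour. One cop wins on the underlying graph by starting at the further vertex.
  The numbers \<open>2\<^sup>i\<close> form a Sidon set, so any two closed out-neighbourhoods meet in at most one
  vertex of \<open>\<int>/n\<close>. The robber, who stays in \<open>\<int>/n\<close>, has \<open>m + 1\<close> possible positions in each round,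
  and each of \<open>m\<close> cops threatens at most one of them.
\<close>

section \<open>Criteria for escape and for capture\<close>

text \<open>Pigeonhole: by \<open>threat\<close> a cop away from \<open>x\<close> endangers at most
  one option, so \<open>m\<close> cops leave one of more than \<open>m\<close> options safe. The
  cop's position \<open>y\<close> may lie outside \<open>X\<close>.\<close>

lemma robber_escapes:
  fixes G :: "('a, 'b) pre_digraph"
  assumes X: "X \<subseteq> verts G" "X \<noteq> {}"
    and options: "\<And>x. x \<in> X \<Longrightarrow> m < card {u \<in> X. agent_move G x u}"
    and threat: "\<And>x y u v. \<lbrakk>x \<in> X; y \<noteq> x; u \<in> X; v \<in> X; agent_move G x u; agent_move G x v;
      agent_move G y u; agent_move G y v\<rbrakk> \<Longrightarrow> u = v"
  shows "\<not> cops_win G m"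
proof
  assume "cops_win G m"
  then obtain s where s: "cop_strategy G m s"
    and win: "\<And>r. robber_play G r \<Longrightarrow>
      \<exists>t. r t \<in> set (cops_at s r t) \<or> r t \<in> set (cops_at s r (Suc t))"
    unfolding cops_win_def winning_cop_strategy_def by blast
  \<comment> \<open>Since staying counts as a move, this excludes both the cops' present positions
    and all they can reach next.\<close>
  define safe where "safe C u \<longleftrightarrow> u \<in> X \<and> (\<forall>c \<in> set C. \<not> agent_move G c u)" for C u
  have step: "\<exists>u. agent_move G x u \<and> safe C u"
    if x: "x \<in> X" and C: "x \<notin> set C" "length C = m" for x C
  proof (rule ccontr)
    let ?U = "{u \<in> X. agent_move G x u}"
    assume "\<not> ?thesis"
    then have "\<forall>u \<in> ?U. \<exists>c \<in> set C. agent_move G c u"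
      unfolding safe_def by blast
    then obtain f where f: "\<And>u. u \<in> ?U \<Longrightarrow> f u \<in> set C \<and> agent_move G (f u) u"
      by metis
    have "inj_on f ?U"
    proof (rule inj_onI)
      fix u v
      assume uv: "u \<in> ?U" "v \<in> ?U" and "f u = f v"
      then have "agent_move G (f u) u" "agent_move G (f u) v" "f u \<noteq> x"
        using f C(1) by metis+
      then show "u = v"
        using threat[OF x, of "f u" u v] uv by blast
    qed
    moreover have "f ` ?U \<subseteq> set C"
      using f by blast
    ultimately have "card ?U \<le> card (set C)"
      by (intro card_inj_on_le) auto
    also have "\<dots> \<le> m"
      using card_length[of C] C(2) by simp
    finally show False
      using options[OF x] by simp
  qed
  have len0: "length (s []) = m"
    using s unfolding cop_strategy_def by blast
  \<comment> \<open>Counting yields a vertex of \<open>X\<close> free of cops; one application of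
    \<open>step\<close> from it gives a safe starting vertex.\<close>
  have "\<exists>x. safe (s []) x"
  proof -
    obtain x where "x \<in> X" using X by blast
    then have "card (set (s [])) < card {u \<in> X. agent_move G x u}"
      using options card_length[of "s []"] len0 by fastforce
    then have "\<not> {u \<in> X. agent_move G x u} \<subseteq> set (s [])"
      by (meson List.finite_set card_mono not_le)
    then show ?thesis
      using step len0 by blast
  qed
  then obtain r0 where r0: "safe (s []) r0" by blast
  \<comment> \<open>The default \<open>x\<close> makes every value a legal move, so
    \<open>robber_play\<close> holds before safety is known; legality of the cops' moves is only
    given along such plays.\<close>
  define next_pos where
    "next_pos x C = (if \<exists>u. agent_move G x u \<and> safe C u
       then SOME u. agent_move G x u \<and> safe C u else x)" for x C
  \<comment> \<open>\<open>hist t\<close> lists \<open>r 0\<close> to \<open>r t\<close>, so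
    \<open>s (hist t)\<close> is \<open>cops_at s r (Suc t)\<close>, the placement the robber
    answers with \<open>r (Suc t)\<close>.\<close>
  define hist where
    "hist = rec_nat [r0] (\<lambda>_ h. h @ [next_pos (last h) (s h)])"
  define r where "r t = last (hist t)" for t
  have hist_Suc: "hist (Suc t) = hist t @ [next_pos (r t) (s (hist t))]" for t
    by (simp add: hist_def r_def)
  have r_0: "r 0 = r0"
    by (simp add: r_def hist_def)
  have r_Suc: "r (Suc t) = next_pos (r t) (s (hist t))" for t
    by (simp add: hist_Suc r_def[of "Suc t"])
  have hist: "hist t = map r [0..<Suc t]" for t
  proof (induction t)
    case 0
    then show ?case by (simp add: r_0) (simp add: hist_def)
  next
    case (Suc t)
    then show ?case by (simp add: hist_Suc r_Suc)
  qed
  have next_pos_safe: "agent_move G x (next_pos x C) \<and> safe C (next_pos x C)"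
    if "\<exists>u. agent_move G x u \<and> safe C u" for x C
    using someI_ex[OF that] that by (simp add: next_pos_def)
  then have "agent_move G x (next_pos x C)" for x C
    by (cases "\<exists>u. agent_move G x u \<and> safe C u") (auto simp: next_pos_def agent_move_def)
  then have play: "robber_play G r"
    using r0 X by (auto simp: robber_play_def r_0 r_Suc safe_def)
  then have moves: "list_all2 (agent_move G) (cops_at s r t) (cops_at s r (Suc t))" for t
    using s unfolding cop_strategy_def by blast
  have len: "length (cops_at s r t) = m" for t
  proof (induction t)
    case 0
    then show ?case using len0 by (simp add: cops_at_def)
  next
    case (Suc t)
    then show ?case using list_all2_lengthD[OF moves] by metis
  qed
  have uncaught: "r t \<notin> set (cops_at s r t) \<and> r t \<notin> set (cops_at s r (Suc t))"
    if "safe (cops_at s r t) (r t)" for t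
  proof
    show "r t \<notin> set (cops_at s r t)"
      using that by (auto simp: safe_def agent_move_def)
    show "r t \<notin> set (cops_at s r (Suc t))"
      using that moves[of t] unfolding safe_def
      by (metis in_set_conv_nth list_all2_conv_all_nth)
  qed
  have "safe (cops_at s r t) (r t)" for t
  proof (induction t)
    case 0
    then show ?case using r0 by (simp add: cops_at_def r_0)
  next
    case (Suc t)
    then have "\<exists>u. agent_move G (r t) u \<and> safe (cops_at s r (Suc t)) u"
      using step uncaught len safe_def by blast
    then show ?case
      using next_pos_safe by (simp only: r_Suc hist cops_at_def)
  qed
  then show False
    using win[OF play] uncaught by blast
qed

text \<open>From \<open>z\<close> the cop steps onto \<open>r 0\<close> in the first round.
  Afterwards it repeats the robber's own moves, which keeps the strategy legal.\<close>

lemma cops_win_1_if_universal: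
  assumes "wf_digraph G" "symmetric G" "z \<in> verts G"
    and z: "\<And>x. x \<in> verts G \<Longrightarrow> agent_move G z x"
  shows "cops_win G 1"
proof -
  let ?s = "\<lambda>h. if h = [] then [z] else [last h]"
  have cops: "cops_at ?s r t = (case t of 0 \<Rightarrow> [z] | Suc t \<Rightarrow> [r t])" for r t
    by (simp add: cops_at_def split: nat.split)
  have "winning_cop_strategy G 1 ?s"
    unfolding winning_cop_strategy_def cop_strategy_def cops
    using assms by (auto simp: robber_play_def split: nat.split)
  then show ?thesis
    unfolding cops_win_def by blast
qed

section \<open>Powers of two as a Sidon set\<close>

text \<open>An exponent exceeding both exponents of the other side would make its side larger. So
  the larger exponents agree, and that term cancels.\<close>

lemma power2_sidon:
  fixes a b c d :: nat
  assumes "(2::nat) ^ a + 2 ^ b = 2 ^ c + 2 ^ d"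
  shows "(a = c \<and> b = d) \<or> (a = d \<and> b = c)"
proof -
  have less: "(2::nat) ^ i + 2 ^ j < 2 ^ k + 2 ^ l" if "i < k" "j < k" for i j k l :: nat
  proof -
    obtain k' where k': "k = Suc k'" using \<open>i < k\<close> by (cases k) simp_all
    then have "(2::nat) ^ i \<le> 2 ^ k'" "(2::nat) ^ j \<le> 2 ^ k'"
      using that by auto
    then have "(2::nat) ^ i + 2 ^ j \<le> 2 ^ k"
      unfolding k' power_Suc by linarith
    moreover have "(2::nat) ^ l > 0" by simp
    ultimately show ?thesis by linarith
  qed
  have "\<not> (a < c \<and> b < c)" "\<not> (a < d \<and> b < d)" "\<not> (c < a \<and> d < a)" "\<not> (c < b \<and> d < b)"
    using less[of a c b d] less[of a d b c] less[of c a d b] less[of c b d a] assms by auto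
  then have "a = c \<or> a = d \<or> b = c \<or> b = d"
    by linarith
  then show ?thesis
    using assms by auto
qed

text \<open>
  The vertices below \<open>n\<close> represent \<open>\<int>/n\<close>, and \<open>n\<close> itself is the further vertex. The congruence says
  \<open>y = x + (2\<^sup>i - 1)\<close> without truncated subtraction; \<open>i = 0\<close> would correspond to staying in place.
\<close>

definition sidon_digraph :: "nat \<Rightarrow> (nat, nat \<times> nat) pre_digraph" where
  "sidon_digraph m = (let n = 2 ^ (m + 2) in
     \<lparr> verts = {..n},
       arcs = {(x, y). x < n \<and> y < n \<and> (\<exists>i \<in> {1..m}. [x + 2 ^ i = y + 1] (mod n))}
         \<union> {(x, n) | x. 0 < x \<and> x < n} \<union> {(n, 0)},
       tail = fst, head = snd \<rparr>)"

section \<open>Structure of the digraph\<close>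

context
  fixes m n :: nat
  defines "n \<equiv> 2 ^ (m + 2)"
begin

lemma modulus_pos: "n > 0"
  by (simp add: n_def)

text \<open>The reason for the size of \<open>n\<close>: congruent sums of two such powers are
  equal, so the Sidon property passes to residues.\<close>

lemma sum_powers_less_modulus:
  assumes "i \<le> m" "j \<le> m"
  shows "2 ^ i + 2 ^ j < n"
proof -
  have "(2::nat) ^ i \<le> 2 ^ m" "(2::nat) ^ j \<le> 2 ^ m"
    using assms by simp_all
  moreover have "n = 4 * 2 ^ m" "(2::nat) ^ m > 0"
    by (simp_all add: n_def)
  ultimately show ?thesis by linarith
qed

lemma verts_sidon_digraph: "verts (sidon_digraph m) = {..n}"
  by (simp add: sidon_digraph_def n_def Let_def)

lemma arc_sidon_digraph:
  "u \<rightarrow>\<^bsub>sidon_digraph m\<^esub> v \<longleftrightarrow>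
    (u < n \<and> v < n \<and> (\<exists>i \<in> {1..m}. [u + 2 ^ i = v + 1] (mod n))) \<or>
    (0 < u \<and> u < n \<and> v = n) \<or> (u = n \<and> v = 0)"
  by (auto simp: sidon_digraph_def n_def Let_def arcs_ends_def arc_to_ends_def image_iff)

lemma agent_move_sidon_digraph:
  assumes "u < n" "v < n"
  shows "agent_move (sidon_digraph m) u v \<longleftrightarrow> (\<exists>i \<le> m. [u + 2 ^ i = v + 1] (mod n))"
proof -
  have "{..m} = insert 0 {1..m}" by auto
  then have "(\<exists>i \<le> m. [u + 2 ^ i = v + 1] (mod n)) \<longleftrightarrow>
      [u + 1 = v + 1] (mod n) \<or> (\<exists>i \<in> {1..m}. [u + 2 ^ i = v + 1] (mod n))"
    by (metis atMost_iff insert_iff power_0)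
  moreover have "[u + 1 = v + 1] (mod n) \<longleftrightarrow> v = u"
    using assms by (metis cong_add_rcancel_nat cong_less_modulus_unique_nat cong_refl)
  ultimately show ?thesis
    using assms by (auto simp: agent_move_def arc_sidon_digraph)
qed

text \<open>Adding the congruences of two opposite arcs gives \<open>2 ^ i + 2 ^ j\<close> congruent
  to 2, but for positive exponents the sum is at least 4 and below \<open>n\<close>.\<close>

lemma oriented_graph_sidon_digraph: "oriented_graph (sidon_digraph m)"
proof -
  let ?D = "sidon_digraph m"
  have arcs: "arcs ?D = {(u, v). u \<rightarrow>\<^bsub>?D\<^esub> v}" "tail ?D = fst" "head ?D = snd"
    by (auto simp: sidon_digraph_def Let_def arcs_ends_def arc_to_ends_def)
  have sub: "arcs ?D \<subseteq> {..n} \<times> {..n}"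
    unfolding arcs by (auto simp: arc_sidon_digraph)
  have anti: "\<not> (u \<rightarrow>\<^bsub>?D\<^esub> v \<and> v \<rightarrow>\<^bsub>?D\<^esub> u)" for u v
  proof
    assume uv: "u \<rightarrow>\<^bsub>?D\<^esub> v \<and> v \<rightarrow>\<^bsub>?D\<^esub> u"
    then have "u < n" "v < n"
      using modulus_pos by (auto simp: arc_sidon_digraph)
    with uv obtain i j where ij: "i \<in> {1..m}" "j \<in> {1..m}"
      and c: "[u + 2 ^ i = v + 1] (mod n)" "[v + 2 ^ j = u + 1] (mod n)"
      by (auto simp: arc_sidon_digraph)
    have "[(u + v) + (2 ^ i + 2 ^ j) = (u + v) + 2] (mod n)"
      using cong_add[OF c] by (simp add: algebra_simps)
    then have "[2 ^ i + 2 ^ j = 2] (mod n)"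
      by (simp only: cong_add_lcancel_nat)
    moreover have "2 < n"
      using sum_powers_less_modulus[of 0 0] by simp
    ultimately have "(2::nat) ^ i + 2 ^ j = 2"
      using sum_powers_less_modulus[of i j] ij
      by (intro cong_less_modulus_unique_nat) auto
    moreover have "(2::nat) ^ 1 \<le> 2 ^ i" "(2::nat) ^ 1 \<le> 2 ^ j"
      using ij by (intro power_increasing; simp)+
    ultimately show False by simp
  qed
  show ?thesis
  proof unfold_locales
    show "finite (arcs ?D)"
      using sub by (rule finite_subset) simp
    show "tail ?D e \<in> verts ?D" "head ?D e \<in> verts ?D" if "e \<in> arcs ?D" for e
      using that sub by (auto simp: verts_sidon_digraph arcs(2,3))
    show "finite (verts ?D)"
      by (simp add: verts_sidon_digraph)
    \<comment> \<open>A loop would be its own opposite arc.\<close>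
    show "tail ?D e \<noteq> head ?D e" if "e \<in> arcs ?D" for e
      using that anti by (cases e) (auto simp: arcs)
    show "e1 = e2" if "arc_to_ends ?D e1 = arc_to_ends ?D e2" for e1 e2
      using that by (simp add: arc_to_ends_def arcs(2,3) prod_eq_iff)
    show "\<not> v \<rightarrow>\<^bsub>?D\<^esub> u" if "u \<rightarrow>\<^bsub>?D\<^esub> v" for u v
      using that anti by blast
  qed
qed

text \<open>The exponent 1 gives the path from 0 through all vertices below \<open>n\<close>, and
  vertex 1 leads on to \<open>n\<close>. Back to 0, every other vertex goes through
  \<open>n\<close>.\<close>

lemma strongly_connected_sidon_digraph:
  assumes "m > 0"
  shows "strongly_connected (sidon_digraph m)"
proof -
  let ?D = "sidon_digraph m"
  interpret oriented_graph ?D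
    by (rule oriented_graph_sidon_digraph)
  have below: "0 \<rightarrow>\<^sup>*\<^bsub>?D\<^esub> v" if "v < n" for v
    using that
  proof (induction v)
    case 0
    then show ?case by (simp add: verts_sidon_digraph)
  next
    case (Suc v)
    have "v \<rightarrow>\<^bsub>?D\<^esub> Suc v"
      using Suc.prems assms by (auto simp: arc_sidon_digraph intro!: bexI[of _ 1])
    then show ?case
      using Suc by (meson Suc_lessD reachable_adj_trans)
  qed
  have "1 < n"
    using sum_powers_less_modulus[of 0 0] by simp
  then have "0 \<rightarrow>\<^sup>*\<^bsub>?D\<^esub> 1" "1 \<rightarrow>\<^bsub>?D\<^esub> n"
    using below by (auto simp: arc_sidon_digraph)
  then have "0 \<rightarrow>\<^sup>*\<^bsub>?D\<^esub> n"
    by (rule reachable_adj_trans)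
  then have from_0: "0 \<rightarrow>\<^sup>*\<^bsub>?D\<^esub> v" if "v \<in> verts ?D" for v
    using that below by (cases "v = n") (auto simp: verts_sidon_digraph)
  have "n \<rightarrow>\<^bsub>?D\<^esub> 0"
    by (simp add: arc_sidon_digraph)
  moreover have "u \<rightarrow>\<^bsub>?D\<^esub> n" if "0 < u" "u < n" for u
    using that by (simp add: arc_sidon_digraph)
  ultimately have to_0: "u \<rightarrow>\<^sup>*\<^bsub>?D\<^esub> 0" if "u \<in> verts ?D" for u
    using that from_0
    by (metis atMost_iff adj_reachable_trans gr0I le_neq_implies_less reachable_adjI verts_sidon_digraph)
  show ?thesis
    unfolding strongly_connected_def
    using from_0 to_0 reachable_trans verts_sidon_digraph by blast
qed

section \<open>The game on the digraph and on its underlying graph\<close>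

lemma cops_lose_sidon_digraph:
  assumes "m' \<le> m"
  shows "\<not> cops_win (sidon_digraph m) m'"
proof (rule robber_escapes)
  let ?D = "sidon_digraph m"
  show "{..<n} \<subseteq> verts ?D" "{..<n} \<noteq> {}"
    using modulus_pos by (auto simp: verts_sidon_digraph)
  show "m' < card {u \<in> {..<n}. agent_move ?D x u}" if "x \<in> {..<n}" for x
  proof -
    \<comment> \<open>The option with exponent \<open>i\<close>; exponent 0 gives \<open>x\<close>
      itself, hence \<open>m + 1\<close> options.\<close>
    let ?f = "\<lambda>i. (x + (2 ^ i - 1)) mod n"
    have f: "[x + 2 ^ i = ?f i + 1] (mod n)" for i
    proof -
      have "x + 2 ^ i = (x + (2 ^ i - 1)) + 1" by simp
      then show ?thesis
        by (simp only: cong_def mod_add_left_eq)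
    qed
    have "inj_on ?f {..m}"
    proof (rule inj_onI)
      fix i j
      assume ij: "i \<in> {..m}" "j \<in> {..m}" "?f i = ?f j"
      then have "[x + 2 ^ i = x + 2 ^ j] (mod n)"
        using f by (metis cong_sym cong_trans)
      then have "[2 ^ i = 2 ^ j] (mod n)"
        by (simp only: cong_add_lcancel_nat)
      moreover have "2 ^ i < n" "2 ^ j < n"
        using sum_powers_less_modulus[of i j] ij by auto
      ultimately show "i = j"
        using cong_less_modulus_unique_nat[of "2 ^ i" "2 ^ j" n] by simp
    qed
    then have "card (?f ` {..m}) = Suc m"
      by (simp add: card_image)
    moreover have "?f ` {..m} \<subseteq> {u \<in> {..<n}. agent_move ?D x u}"
    proof
      fix u
      assume "u \<in> ?f ` {..m}"
      then obtain i where "i \<le> m" "u = ?f i" by auto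
      then show "u \<in> {u \<in> {..<n}. agent_move ?D x u}"
        using that f modulus_pos agent_move_sidon_digraph[of x u] by auto
    qed
    ultimately have "Suc m \<le> card {u \<in> {..<n}. agent_move ?D x u}"
      using card_mono[of "{u \<in> {..<n}. agent_move ?D x u}" "?f ` {..m}"] by simp
    then show ?thesis
      using assms by simp
  qed
  show "u = v" if x: "x \<in> {..<n}" and "y \<noteq> x" and u: "u \<in> {..<n}" and v: "v \<in> {..<n}"
    and xy: "agent_move ?D x u" "agent_move ?D x v" "agent_move ?D y u" "agent_move ?D y v"
    for x y u v
  proof (cases "y < n")
    \<comment> \<open>A cop at \<open>n\<close> threatens only 0 among the vertices below
      \<open>n\<close>.\<close>
    case False
    then show ?thesis
      using xy(3,4) u v by (auto simp: agent_move_def arc_sidon_digraph)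
  next
    case True
    obtain i j k l where le: "i \<le> m" "j \<le> m" "k \<le> m" "l \<le> m"
      and c: "[x + 2 ^ i = u + 1] (mod n)" "[x + 2 ^ j = v + 1] (mod n)"
        "[y + 2 ^ k = u + 1] (mod n)" "[y + 2 ^ l = v + 1] (mod n)"
      using xy x u v True by (auto simp: agent_move_sidon_digraph)
    \<comment> \<open>Both sides are congruent to \<open>(u + 1) + (v + 1)\<close>; cancelling
      \<open>x + y\<close> leaves powers only.\<close>
    have "[(x + 2 ^ i) + (y + 2 ^ l) = (y + 2 ^ k) + (x + 2 ^ j)] (mod n)"
      using c by (meson cong_add cong_sym cong_trans)
    then have "[(x + y) + (2 ^ i + 2 ^ l) = (x + y) + (2 ^ k + 2 ^ j)] (mod n)"
      by (simp add: algebra_simps)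
    then have "[2 ^ i + 2 ^ l = 2 ^ k + 2 ^ j] (mod n)"
      by (simp only: cong_add_lcancel_nat)
    then have "(2::nat) ^ i + 2 ^ l = 2 ^ k + 2 ^ j"
      using sum_powers_less_modulus le by (intro cong_less_modulus_unique_nat) auto
    then consider "i = k" | "i = j"
      using power2_sidon by blast
    then show ?thesis
    proof cases
      case 1
      then have "[x + 2 ^ i = y + 2 ^ i] (mod n)"
        using c by (meson cong_sym cong_trans)
      then have "[x = y] (mod n)"
        by (simp only: cong_add_rcancel_nat)
      then show ?thesis
        using cong_less_modulus_unique_nat[of x y n] x True \<open>y \<noteq> x\<close> by simp
    next
      case 2
      then have "[u + 1 = v + 1] (mod n)"
        using c by (meson cong_sym cong_trans)
      then have "[u = v] (mod n)"
        by (simp only: cong_add_rcancel_nat)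
      then show ?thesis
        using cong_less_modulus_unique_nat[of u v n] u v by simp
    qed
  qed
qed

text \<open>Every other vertex shares an arc with \<open>n\<close> in some direction, so
  \<open>n\<close> is universal once directions are dropped.\<close>

lemma cops_win_1_underlying_sidon_digraph:
  "cops_win (with_proj (mk_symmetric (sidon_digraph m))) 1"
proof (rule cops_win_1_if_universal)
  let ?D = "sidon_digraph m"
  interpret oriented_graph ?D
    by (rule oriented_graph_sidon_digraph)
  interpret G: pair_wf_digraph "mk_symmetric ?D" ..
  show "wf_digraph (with_proj (mk_symmetric ?D))" ..
  show "symmetric (with_proj (mk_symmetric ?D))"
    by (rule symmetric_mk_symmetric)
  show "n \<in> verts (with_proj (mk_symmetric ?D))"
    by (simp add: verts_sidon_digraph)
  show "agent_move (with_proj (mk_symmetric ?D)) n x"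
    if "x \<in> verts (with_proj (mk_symmetric ?D))" for x
  proof -
    have "x = n \<or> x \<rightarrow>\<^bsub>?D\<^esub> n \<or> n \<rightarrow>\<^bsub>?D\<^esub> x"
      using that by (auto simp: verts_sidon_digraph arc_sidon_digraph)
    then show ?thesis
      by (auto simp: agent_move_def parcs_mk_symmetric arcs_ends_conv)
  qed
qed

end

theorem corollary7:
  fixes k :: nat
  shows "\<exists>D :: (nat, nat \<times> nat) pre_digraph.
    oriented_graph D \<and> strongly_connected D \<and>
    int (cop_number D) - int (cop_number (with_proj (mk_symmetric D))) > int k"
proof -
  \<comment> \<open>\<open>Suc k\<close> is positive, as strong connectivity requires, and forces a
    cop number of at least \<open>k + 2\<close> against at most 1.\<close>
  let ?D = "sidon_digraph (Suc k)"
  interpret oriented_graph ?D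
    by (rule oriented_graph_sidon_digraph)
  have "\<not> cop_number ?D \<le> Suc k"
    using cops_lose_sidon_digraph cops_win_cop_number by blast
  moreover have "cop_number (with_proj (mk_symmetric ?D)) \<le> 1"
    unfolding cop_number_def by (rule Least_le) (rule cops_win_1_underlying_sidon_digraph)
  ultimately have "int (cop_number ?D) - int (cop_number (with_proj (mk_symmetric ?D))) > int k"
    by linarith
  then show ?thesis
    using oriented_graph_sidon_digraph strongly_connected_sidon_digraph by blast
qed

end
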